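(* For every complex number $a$ with $2a+\tfrac12\notin\{0,-1,-2,\dots\}$, $$F_1\left(3a;\,1-a,\,5a-\tfrac32;\,2a+\tfrac12;\,\tfrac3{128},\tfrac1{16}\right)=\frac{2^{15a}}{3\cdot5^{5a}}\,\frac{\Gamma(a)\,\Gamma(2a+1/2)}{\sqrt\pi\,\Gamma(3a)},$$ where the quotient $\Gamma(a)/\Gamma(3a)$ is understood as an entire function of $a$ (its removable singularities at $a=0,-1,-2,\dots$ being filled in by continuity).
   Context: Appell's hypergeometric series is $F_1(\alpha;\beta_1,\beta_2;\gamma;x,y)=\sum_{m,n\ge0}\frac{(\alpha,m+n)(\beta_1,m)(\beta_2,n)}{(\gamma,m+n)(1,m)(1,n)}x^my^n$ for $\gamma\notin\{0,-1,-2,\dots\}$, absolutely convergent for $|x|<1$, $|y|<1$, where $(\alpha,n)=\alpha(\alpha+1)\cdots(\alpha+n-1)$, $(\alpha,0)=1$. For real $r>0$, $r^{a}=e^{a\log r}$ with real $\log r$. $1/\Gamma$ is the entire function (zero at the poles of $\Gamma$). *)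

theory Defs
  imports "HOL-Complex_Analysis.Complex_Analysis"
begin

text \<open>
  Appell's double series, with the rising factorial $(\alpha,n)$ rendered as
  \<^term>\<open>pochhammer \<alpha> n\<close>. The definition is meaningful for \<open>\<gamma> \<notin> \<int>\<^sub>\<le>\<^sub>0\<close> and
  \<open>norm x < 1\<close>, \<open>norm y < 1\<close>, where the series converges absolutely; over the
  complex numbers unordered summability is the same as absolute summability.
\<close>

definition appell_F1 ::
  "complex \<Rightarrow> complex \<Rightarrow> complex \<Rightarrow> complex \<Rightarrow> complex \<Rightarrow> complex \<Rightarrow> complex" where
  "appell_F1 \<alpha> \<beta>1 \<beta>2 \<gamma> x y =
     (\<Sum>\<^sub>\<infinity>(m, n)\<in>UNIV.
        pochhammer \<alpha> (m + n) * pochhammer \<beta>1 m * pochhammer \<beta>2 n /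
        (pochhammer \<gamma> (m + n) * pochhammer 1 m * pochhammer 1 n) * x ^ m * y ^ n)"

text \<open>
  The entire function $\Gamma(a)/\Gamma(3a)$. In the library \<^term>\<open>Gamma\<close> takes the value 0
  at its poles, so the bare product below has the wrong value at $a = 0, -1, -2, \ldots$;
  \<^term>\<open>remove_sings\<close> replaces the value at each point by the limit there.
\<close>

definition Gamma_quot3 :: "complex \<Rightarrow> complex" where
  "Gamma_quot3 = remove_sings (\<lambda>z. Gamma z * rGamma (3 * z))"

end

theory Submission
  imports Defs
begin

text \<open>
  For real \<open>a\<close> with \<open>3/10 < a < 1/2\<close> every term of the series is positive, and Euler's integral
  expresses its sum through the integral over \<open>0 < t < 1\<close> of
  \<open>t^(3a-1) (1-t)^(-a-1/2) (1-3t/128)^(a-1) (1-t/16)^(3/2-5a)\<close>.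
  Put \<open>w = k t^3 (1-3t/128) / ((1-t) (1-t/16)^5)\<close> with \<open>k = 5^5/2^15\<close>. There is a cubic \<open>P\<close>
  with \<open>1 + w = P^2 / ((1-t) (1-t/16)^5)\<close>, and the same \<open>P\<close> appears in
  \<open>w'/w = 3P / (t (1-t) (1-3t/128) (1-t/16))\<close>. The substitution \<open>s = w/(1+w)\<close> therefore
  turns the integral into a constant multiple of the Beta integral \<open>B(a, 1/2-a)\<close>.
  Both sides are analytic in \<open>a\<close> on the connected set \<open>2a + 1/2 \<notin> \<int>\<^sub>\<le>\<^sub>0\<close>, so the identity
  theorem gives the general case.
\<close>

section \<open>The quotient $\Gamma(a)/\Gamma(3a)$\<close>

text \<open>The half plane moves left one unit at a time:
  \<open>Gamma w = Gamma (w + 1) / w\<close>, while \<open>rGamma (3 * w)\<close> equals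
  \<open>3 * w * (3 * w + 1) * (3 * w + 2)\<close> times \<open>rGamma (3 * (w + 1))\<close>, so the
  pole factor \<open>w\<close> cancels. Agreement is asked only on a punctured neighbourhood because
  at a pole of \<open>Gamma\<close> the product takes the value 0 instead of its limit.\<close>

lemma Gamma_times_rGamma_triple_eventually_analytic:
  fixes z :: complex
  assumes "Re z > - real n"
  shows "\<exists>h. h analytic_on {z} \<and> (\<forall>\<^sub>F w in at z. Gamma w * rGamma (3 * w) = h w)"
  using assms
proof (induction n arbitrary: z)
  case 0
  hence "z \<notin> \<int>\<^sub>\<le>\<^sub>0"
    by (auto elim!: nonpos_Ints_cases)
  hence "(\<lambda>w. Gamma w * rGamma (3 * w)) analytic_on {z}"
    by (intro analytic_intros) auto
  thus ?case
    by (intro exI[of _ "\<lambda>w. Gamma w * rGamma (3 * w)"]) simp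
next
  case (Suc n)
  from Suc.prems obtain h where h: "h analytic_on {z + 1}"
    "\<forall>\<^sub>F w in at (z + 1). Gamma w * rGamma (3 * w) = h w"
    using Suc.IH[of "z + 1"] by auto
  have "\<forall>\<^sub>F w in filtermap (\<lambda>w. w - (- 1)) (at z). Gamma w * rGamma (3 * w) = h w"
    using h(2) by (subst filtermap_at_shift) simp
  hence ev: "\<forall>\<^sub>F w in at z. Gamma (w + 1) * rGamma (3 * (w + 1)) = h (w + 1)"
    by (simp add: eventually_filtermap)
  \<comment> \<open>The point \<open>z\<close> may itself be a pole, so only the other non-positive
    integers have to be avoided; they form a closed set.\<close>
  have "\<forall>\<^sub>F w in at z. w \<notin> \<int>\<^sub>\<le>\<^sub>0"
  proof -
    have "closed (\<int>\<^sub>\<le>\<^sub>0 - {z})"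
      by (intro closed_subset_Ints) auto
    hence "\<forall>\<^sub>F w in at z. w \<in> - (\<int>\<^sub>\<le>\<^sub>0 - {z})"
      by (intro eventually_at_in_open' open_Compl) auto
    moreover have "\<forall>\<^sub>F w in at z. w \<noteq> z"
      by (rule eventually_neq_at_within)
    ultimately show ?thesis
      by eventually_elim auto
  qed
  hence "\<forall>\<^sub>F w in at z. Gamma w * rGamma (3 * w) = 3 * (3 * w + 1) * (3 * w + 2) * h (w + 1)"
    using ev
  proof eventually_elim
    case (elim w)
    have "w \<noteq> 0"
      using elim(1) by auto
    have "rGamma (3 * w) = 3 * w * (3 * w + 1) * (3 * w + 2) * rGamma (3 * (w + 1))"
      using pochhammer_rGamma[of "3 * w" 3] by (simp add: eval_nat_numeral pochhammer_Suc algebra_simps)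
    thus ?case
      using elim Gamma_plus1[OF elim(1)] \<open>w \<noteq> 0\<close> by (simp flip: elim(2))
  qed
  moreover have "(\<lambda>w. 3 * (3 * w + 1) * (3 * w + 2) * h (w + 1)) analytic_on {z}"
  proof -
    have "(\<lambda>w. w + 1) analytic_on {z}"
      by (intro analytic_intros)
    hence "(\<lambda>w. h (w + 1)) analytic_on {z}"
      using analytic_on_compose[of "\<lambda>w. w + 1" "{z}" h, unfolded o_def] h(1) by simp
    thus ?thesis
      by (intro analytic_intros)
  qed
  ultimately show ?case by blast
qed

text \<open>The value \<open>remove_sings f w\<close> depends on \<open>f\<close> only through a
  punctured neighbourhood of \<open>w\<close>. For every \<open>w\<close> near \<open>z\<close>,
  including \<open>z\<close> itself, \<open>f\<close> agrees there with \<open>h\<close>, so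
  \<open>remove_sings f\<close> equals \<open>h\<close> on a full neighbourhood of
  \<open>z\<close>.\<close>

lemma remove_sings_analytic_at_if_eventually_eq:
  assumes "h analytic_on {z}" "\<forall>\<^sub>F w in at z. f w = h w"
  shows "remove_sings f analytic_on {z}"
proof -
  obtain S where S: "open S" "z \<in> S" "\<And>w. w \<in> S \<Longrightarrow> w \<noteq> z \<Longrightarrow> f w = h w"
    using assms(2) by (auto simp: eventually_at_topological)
  obtain T where T: "open T" "z \<in> T" "h holomorphic_on T"
    using assms(1) by (auto simp: analytic_at)
  have "remove_sings f w = h w" if w: "w \<in> S \<inter> T" for w
  proof -
    have "\<forall>\<^sub>F v in at w. f v = h v"
    proof (cases "w = z")
      case False
      have "\<forall>\<^sub>F v in at w. v \<in> S - {z}"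
        using S w False by (intro eventually_at_in_open') auto
      thus ?thesis by eventually_elim (auto simp: S)
    qed (use assms(2) in simp)
    hence "remove_sings f w = remove_sings h w"
      by (rule remove_sings_cong) simp
    also have "\<dots> = h w"
      using T w analytic_at by (intro remove_sings_at_analytic) blast
    finally show ?thesis .
  qed
  hence "remove_sings f holomorphic_on S \<inter> T \<longleftrightarrow> h holomorphic_on S \<inter> T"
    by (intro holomorphic_cong) auto
  hence "remove_sings f holomorphic_on S \<inter> T"
    using T holomorphic_on_subset by blast
  thus ?thesis
    using S T analytic_at by blast
qed

text \<open>Every \<open>z\<close> lies in some half plane \<open>Re z > - n\<close>, so the
  quotient is entire, and the identity theorem also reaches the filled-in points
  \<open>0, -1, -2, ...\<close>.\<close>

lemma Gamma_quot3_analytic: "Gamma_quot3 analytic_on {z}"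
proof -
  obtain n where "- Re z < real n"
    using reals_Archimedean2 by blast
  thus ?thesis
    unfolding Gamma_quot3_def
    using Gamma_times_rGamma_triple_eventually_analytic[of n z] remove_sings_analytic_at_if_eventually_eq
    by (metis minus_less_iff)
qed

lemma Gamma_quot3_eq: "z \<notin> \<int>\<^sub>\<le>\<^sub>0 \<Longrightarrow> Gamma_quot3 z = Gamma z * rGamma (3 * z)"
  unfolding Gamma_quot3_def
  by (intro remove_sings_at_analytic analytic_intros) auto

section \<open>Analytic dependence of the Appell series on its parameters\<close>

text \<open>Consecutive ratios differ by the factor \<open>(f z + n) / (g z + n)\<close>, which
  tends to 1 uniformly on \<open>K\<close> and so is eventually at most \<open>q\<close>. The
  finitely many earlier ratios are bounded by compactness.\<close>

lemma pochhammer_ratio_bound: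
  fixes f g :: "'a::metric_space \<Rightarrow> complex" and q :: real
  assumes "compact K" "continuous_on K f" "continuous_on K g"
    and g: "\<And>z. z \<in> K \<Longrightarrow> g z \<notin> \<int>\<^sub>\<le>\<^sub>0"
    and q: "q > 1"
  shows "\<exists>C\<ge>0. \<forall>z\<in>K. \<forall>n. norm (pochhammer (f z) n / pochhammer (g z) n) \<le> C * q ^ n"
proof -
  let ?r = "\<lambda>z n. pochhammer (f z) n / pochhammer (g z) n"
  have "bounded (f ` K)" "bounded (g ` K)"
    using assms by (auto intro!: compact_imp_bounded compact_continuous_image)
  then obtain R1 R2 where R12: "\<And>z. z \<in> K \<Longrightarrow> norm (f z) \<le> R1" "\<And>z. z \<in> K \<Longrightarrow> norm (g z) \<le> R2"
    unfolding bounded_iff by auto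
  define R where "R = max 1 (max R1 R2)"
  have R: "norm (f z) \<le> R" "norm (g z) \<le> R" if "z \<in> K" for z
    using R12[OF that] by (auto simp: R_def)
  have "R \<ge> 1" by (simp add: R_def)
  \<comment> \<open>For \<open>n\<close> at least this \<open>N\<close> one has
    \<open>R + n <= q * (n - R)\<close>, which bounds the factor
    \<open>(f z + n) / (g z + n)\<close> by \<open>q\<close>.\<close>
  obtain N :: nat where N: "(R * (1 + q)) / (q - 1) < real N"
    using reals_Archimedean2 by blast
  have pg: "pochhammer (g z) n \<noteq> 0" if "z \<in> K" for z n
    using g[OF that] pochhammer_eq_0_imp_nonpos_Int by blast
  have "\<exists>B. \<forall>z\<in>K. norm (?r z n) \<le> B" for n
  proof -
    have "continuous_on K (\<lambda>z. ?r z n)"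
      unfolding pochhammer_prod using pg
      by (intro continuous_intros assms) (auto simp: pochhammer_prod)
    hence "bounded ((\<lambda>z. ?r z n) ` K)"
      using assms(1) by (auto intro!: compact_imp_bounded compact_continuous_image)
    thus ?thesis unfolding bounded_iff by auto
  qed
  then obtain B where B: "\<And>z n. z \<in> K \<Longrightarrow> norm (?r z n) \<le> B n" by metis
  define C where "C = (\<Sum>n\<le>N. \<bar>B n\<bar>)"
  have "C \<ge> 0" by (auto simp: C_def intro!: sum_nonneg)
  have "norm (?r z n) \<le> C * q ^ n" if z: "z \<in> K" for z n
  proof (induction n)
    have small: "norm (?r z n) \<le> C * q ^ n" if "n \<le> N" for n
    proof -
      have "norm (?r z n) \<le> \<bar>B n\<bar>" using B[OF z, of n] by linarith
      also have "\<dots> \<le> C" unfolding C_def using that by (intro member_le_sum) auto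
      also have "\<dots> \<le> C * q ^ n" using q \<open>C \<ge> 0\<close> by (simp add: mult_le_cancel_left1)
      finally show ?thesis .
    qed
    case 0
    show ?case by (rule small) simp
    case (Suc n)
    show ?case
    proof (cases "Suc n \<le> N")
      case False
      hence "R * (1 + q) / (q - 1) < real n" using N by linarith
      hence *: "R * (1 + q) < real n * (q - 1)" using q by (simp add: field_simps)
      have "R * (q - 1) \<le> R * (1 + q)" using \<open>R \<ge> 1\<close> by (intro mult_left_mono) auto
      hence "R * (q - 1) < real n * (q - 1)" using * by linarith
      hence "R < real n" using q by simp
      have "norm (f z + of_nat n) \<le> R + real n"
        using R(1)[OF z] by (intro norm_triangle_le) auto
      also have "\<dots> \<le> q * (real n - R)" using * by (simp add: algebra_simps)
      also have "\<dots> \<le> q * norm (g z + of_nat n)"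
      proof (intro mult_left_mono)
        show "real n - R \<le> norm (g z + of_nat n)"
          using R(2)[OF z] norm_diff_ineq[of "of_nat n :: complex" "g z"] by (simp add: add.commute)
      qed (use q in auto)
      finally have "norm ((f z + of_nat n) / (g z + of_nat n)) \<le> q"
        using q by (cases "g z + of_nat n = 0") (auto simp: norm_divide field_simps)
      hence "norm (?r z n) * norm ((f z + of_nat n) / (g z + of_nat n)) \<le> (C * q ^ n) * q"
        using Suc by (intro mult_mono) (use q \<open>C \<ge> 0\<close> in auto)
      thus ?thesis
        by (simp add: pochhammer_Suc norm_mult norm_divide mult_ac)
    qed (rule small)
  qed
  thus ?thesis using \<open>C \<ge> 0\<close> by blast
qed

text \<open>Polymorphic in the field, so that the real series treated by Euler's integral and the
  complex series share one summand.\<close>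

definition appell_F1_term ::
  "'a::field_char_0 \<Rightarrow> 'a \<Rightarrow> 'a \<Rightarrow> 'a \<Rightarrow> 'a \<Rightarrow> 'a \<Rightarrow> nat \<times> nat \<Rightarrow> 'a" where
  "appell_F1_term \<alpha> \<beta>1 \<beta>2 \<gamma> x y = (\<lambda>(m, n).
     pochhammer \<alpha> (m + n) * pochhammer \<beta>1 m * pochhammer \<beta>2 n /
     (pochhammer \<gamma> (m + n) * pochhammer 1 m * pochhammer 1 n) * x ^ m * y ^ n)"

lemma appell_F1_eq_infsum: "appell_F1 \<alpha> \<beta>1 \<beta>2 \<gamma> x y = infsum (appell_F1_term \<alpha> \<beta>1 \<beta>2 \<gamma> x y) UNIV"
  by (simp add: appell_F1_def appell_F1_term_def)

text \<open>Each term is a product of three Pochhammer ratios and two powers. Bounding the ratios by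
  powers of a \<open>q\<close> close to 1 leaves a double geometric series that does not depend on
  \<open>z\<close>, as the Weierstrass M-test requires.\<close>

lemma appell_F1_term_bound:
  fixes f1 f2 f3 f4 :: "'a::metric_space \<Rightarrow> complex" and x y :: complex
  assumes K: "compact K" and cont: "continuous_on K f1" "continuous_on K f2" "continuous_on K f3"
    "continuous_on K f4"
    and f4: "\<And>z. z \<in> K \<Longrightarrow> f4 z \<notin> \<int>\<^sub>\<le>\<^sub>0"
    and xy: "norm x < 1" "norm y < 1"
  shows "\<exists>M. M summable_on UNIV \<and>
           (\<forall>z\<in>K. \<forall>p. norm (appell_F1_term (f1 z) (f2 z) (f3 z) (f4 z) x y p) \<le> M p)"
proof -
  define r where "r = max (norm x) (norm y)"
  have r: "0 \<le> r" "r < 1" "norm x \<le> r" "norm y \<le> r"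
    using xy by (auto simp: r_def le_max_iff_disj)
  \<comment> \<open>The index \<open>m\<close> enters two of the three ratios, and so does
    \<open>n\<close>, so \<open>q * q * r < 1\<close> is needed; this choice gives
    \<open>2 * r / (1 + r)\<close>.\<close>
  define q where "q = sqrt (2 / (1 + r))"
  have "q > 1" using r by (simp add: q_def)
  have "q * q = 2 / (1 + r)" using r by (simp add: q_def)
  define s where "s = q * q * r"
  have s: "0 \<le> s" "s < 1" using r \<open>q > 1\<close> unfolding s_def \<open>q * q = _\<close> by (auto simp: field_simps)
  obtain C1 where C1: "C1 \<ge> 0"
    "\<And>z n. z \<in> K \<Longrightarrow> norm (pochhammer (f1 z) n / pochhammer (f4 z) n) \<le> C1 * q ^ n"
    using pochhammer_ratio_bound[OF K cont(1,4) f4 \<open>q > 1\<close>] by metis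
  obtain C2 where C2: "C2 \<ge> 0"
    "\<And>z n. z \<in> K \<Longrightarrow> norm (pochhammer (f2 z) n / pochhammer 1 n) \<le> C2 * q ^ n"
    using pochhammer_ratio_bound[OF K cont(2) _ _ \<open>q > 1\<close>, of "\<lambda>_. 1"] by auto
  obtain C3 where C3: "C3 \<ge> 0"
    "\<And>z n. z \<in> K \<Longrightarrow> norm (pochhammer (f3 z) n / pochhammer 1 n) \<le> C3 * q ^ n"
    using pochhammer_ratio_bound[OF K cont(3) _ _ \<open>q > 1\<close>, of "\<lambda>_. 1"] by auto
  define M where "M = (\<lambda>(m::nat, n::nat). C1 * C2 * C3 * (s ^ m * s ^ n))"
  have "M summable_on UNIV"
  proof -
    have sum: "(\<lambda>n. s ^ n) summable_on UNIV"
      using s by (subst summable_on_UNIV_nonneg_real_iff) (auto intro: summable_geometric)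
    have "(\<lambda>(m, n). s ^ m * s ^ n) summable_on UNIV \<times> UNIV"
    proof (rule summable_on_SigmaI)
      show "((\<lambda>n. case (m, n) of (m, n) \<Rightarrow> s ^ m * s ^ n) has_sum s ^ m * (\<Sum>\<^sub>\<infinity>n. s ^ n)) UNIV" for m :: nat
        unfolding case_prod_conv by (intro has_sum_cmult_right has_sum_infsum sum)
      show "(\<lambda>m. s ^ m * (\<Sum>\<^sub>\<infinity>n. s ^ n)) summable_on UNIV"
        by (intro summable_on_cmult_left sum)
    qed (use s in auto)
    thus ?thesis
      unfolding M_def case_prod_unfold by (intro summable_on_cmult_right) auto
  qed
  moreover have "norm (appell_F1_term (f1 z) (f2 z) (f3 z) (f4 z) x y (m, n)) \<le> M (m, n)" if z: "z \<in> K" for z m n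
  proof -
    have "norm (appell_F1_term (f1 z) (f2 z) (f3 z) (f4 z) x y (m, n)) =
       norm (pochhammer (f1 z) (m + n) / pochhammer (f4 z) (m + n)) *
       norm (pochhammer (f2 z) m / pochhammer 1 m) * norm (pochhammer (f3 z) n / pochhammer 1 n) *
       norm x ^ m * norm y ^ n"
      by (simp add: appell_F1_term_def norm_mult norm_divide norm_power)
    also have "\<dots> \<le> (C1 * q ^ (m + n)) * (C2 * q ^ m) * (C3 * q ^ n) * r ^ m * r ^ n"
      using C1 C2 C3 z r \<open>q > 1\<close>
      by (intro mult_mono power_mono) (auto intro!: mult_nonneg_nonneg)
    also have "\<dots> = M (m, n)"
      by (simp add: M_def s_def power_add power_mult_distrib mult_ac)
    finally show ?thesis .
  qed
  ultimately show ?thesis by (intro exI[of _ M]) auto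
qed

lemma appell_F1_summable:
  fixes \<alpha> \<beta>1 \<beta>2 \<gamma> x y :: complex
  assumes "\<gamma> \<notin> \<int>\<^sub>\<le>\<^sub>0" "norm x < 1" "norm y < 1"
  shows "appell_F1_term \<alpha> \<beta>1 \<beta>2 \<gamma> x y summable_on UNIV"
proof -
  \<comment> \<open>Fixed parameters are constant functions on a one-point compact set.\<close>
  have "\<exists>M. M summable_on UNIV \<and> (\<forall>z\<in>{0 :: real}. \<forall>p. norm (appell_F1_term \<alpha> \<beta>1 \<beta>2 \<gamma> x y p) \<le> M p)"
    by (rule appell_F1_term_bound) (use assms in simp_all)
  then obtain M where "M summable_on UNIV" "\<And>p. norm (appell_F1_term \<alpha> \<beta>1 \<beta>2 \<gamma> x y p) \<le> M p"
    by blast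
  thus ?thesis
    by (blast intro: abs_summable_summable[OF Infinite_Sum.abs_summable_on_comparison_test'])
qed

text \<open>The finite partial sums are holomorphic and converge uniformly on small closed discs.
  The limit runs along finite index sets because the double series is an unordered sum.\<close>

lemma holomorphic_appell_F1:
  assumes D: "open D" and hol: "f1 holomorphic_on D" "f2 holomorphic_on D" "f3 holomorphic_on D"
    "f4 holomorphic_on D"
    and f4: "\<And>z. z \<in> D \<Longrightarrow> f4 z \<notin> \<int>\<^sub>\<le>\<^sub>0"
    and xy: "norm x < 1" "norm y < 1"
  shows "(\<lambda>z. appell_F1 (f1 z) (f2 z) (f3 z) (f4 z) x y) holomorphic_on D"
proof -
  let ?t = "\<lambda>p z. appell_F1_term (f1 z) (f2 z) (f3 z) (f4 z) x y p"
  have hol_term: "?t p holomorphic_on D" for p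
  proof -
    have "pochhammer (f4 z) n \<noteq> 0" if "z \<in> D" for z n
      using f4[OF that] pochhammer_eq_0_imp_nonpos_Int by blast
    moreover have "pochhammer (1 :: complex) n \<noteq> 0" for n
      by (simp flip: pochhammer_fact)
    ultimately show ?thesis
      unfolding appell_F1_term_def case_prod_unfold
      by (intro holomorphic_intros hol) auto
  qed
  have hol_sum: "(\<lambda>z. \<Sum>p\<in>X. ?t p z) holomorphic_on D" for X
    by (intro holomorphic_intros hol_term)
  have "(\<lambda>z. appell_F1 (f1 z) (f2 z) (f3 z) (f4 z) x y) analytic_on D"
    unfolding analytic_on_def
  proof
    fix z0 assume "z0 \<in> D"
    then obtain e where e: "e > 0" "cball z0 e \<subseteq> D"
      using D open_contains_cball by blast
    have cont: "continuous_on (cball z0 e) f" if "f holomorphic_on D" for f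
      using continuous_on_subset[OF holomorphic_on_imp_continuous_on[OF that] e(2)] .
    obtain M where M: "M summable_on UNIV" "\<And>z p. z \<in> cball z0 e \<Longrightarrow> norm (?t p z) \<le> M p"
      using appell_F1_term_bound[OF compact_cball hol[THEN cont] _ xy] f4 e(2) by (metis subsetD)
    have "uniform_limit (cball z0 e) (\<lambda>X z. \<Sum>p\<in>X. ?t p z) (\<lambda>z. \<Sum>\<^sub>\<infinity>p. ?t p z) (finite_subsets_at_top UNIV)"
      using M by (intro Weierstrass_m_test_general) auto
    moreover have "ball z0 e \<subseteq> D"
      using e(2) ball_subset_cball by (rule order_trans[rotated])
    hence "\<forall>\<^sub>F X in finite_subsets_at_top UNIV. continuous_on (cball z0 e) (\<lambda>z. \<Sum>p\<in>X. ?t p z) \<and>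
             (\<lambda>z. \<Sum>p\<in>X. ?t p z) holomorphic_on ball z0 e"
      by (intro always_eventually allI conjI cont[OF hol_sum] holomorphic_on_subset[OF hol_sum])
    ultimately have "(\<lambda>z. \<Sum>\<^sub>\<infinity>p. ?t p z) holomorphic_on ball z0 e"
      by (auto intro: holomorphic_uniform_limit)
    thus "\<exists>e>0. (\<lambda>z. appell_F1 (f1 z) (f2 z) (f3 z) (f4 z) x y) holomorphic_on ball z0 e"
      using e by (auto simp: appell_F1_eq_infsum)
  qed
  thus ?thesis by (rule analytic_imp_holomorphic)
qed

section \<open>Euler's integral\<close>

text \<open>Newton's binomial series; the sign in \<open>(- b) gchoose n\<close> cancels that of
  \<open>(- x) ^ n\<close>.\<close>

lemma binomial_series_pochhammer_real:
  fixes x b :: real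
  assumes "\<bar>x\<bar> < 1"
  shows "(\<lambda>n. pochhammer b n / pochhammer 1 n * x ^ n) sums (1 - x) powr (- b)"
proof -
  have "(\<lambda>n. ((- b) gchoose n) * (- x) ^ n) sums (1 + (- x)) powr (- b)"
    using assms by (intro gen_binomial_real) auto
  moreover have "((- b) gchoose n) * (- x) ^ n = pochhammer b n / pochhammer 1 n * x ^ n" for n
  proof -
    have "((- b) gchoose n) * (- x) ^ n = ((- 1) ^ n * (- 1) ^ n) * (pochhammer b n / fact n * x ^ n)"
      by (simp only: gbinomial_pochhammer power_minus[of x] minus_minus mult_ac times_divide_eq_left times_divide_eq_right)
    thus ?thesis
      by (simp add: pochhammer_fact)
  qed
  ultimately show ?thesis by simp
qed

text \<open>The factor \<open>t ^ N\<close> shifts the first Beta parameter by \<open>N\<close>, and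
  the resulting Gamma quotients are Pochhammer symbols.\<close>

lemma nn_integral_Beta_moment:
  fixes a d :: real
  assumes "a > 0" "d > 0"
  shows "(\<integral>\<^sup>+t. ennreal (t powr (a - 1) * (1 - t) powr (d - 1) * t ^ N) * indicator {0..1} t \<partial>lborel) =
           ennreal (Beta a d * (pochhammer a N / pochhammer (a + d) N))"
proof -
  have "((\<lambda>t. t powr (a + real N - 1) * (1 - t) powr (d - 1)) has_integral Beta (a + real N) d) {0..1}"
    using assms by (intro has_integral_Beta_real) auto
  \<comment> \<open>At \<open>t = 0\<close> both sides vanish, since \<open>0 powr x = 0\<close> for
    every \<open>x\<close>.\<close>
  moreover have "t powr (a + real N - 1) = t powr (a - 1) * t ^ N" if "t \<in> {0..1}" for t
    using that by (cases "t = 0") (auto simp: powr_add powr_diff powr_realpow)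
  ultimately have "((\<lambda>t. t powr (a - 1) * (1 - t) powr (d - 1) * t ^ N) has_integral Beta (a + real N) d) {0..1}"
    by (subst has_integral_cong[where g = "\<lambda>t. t powr (a + real N - 1) * (1 - t) powr (d - 1)"]) (auto simp: mult_ac)
  hence "(\<integral>\<^sup>+t. ennreal (t powr (a - 1) * (1 - t) powr (d - 1) * t ^ N) * indicator {0..1} t \<partial>lborel) =
           ennreal (Beta (a + real N) d)"
    by (intro nn_integral_has_integral_lebesgue') auto
  also have "Beta (a + real N) d = Beta a d * (pochhammer a N / pochhammer (a + d) N)"
  proof -
    have "a \<notin> \<int>\<^sub>\<le>\<^sub>0" "a + d \<notin> \<int>\<^sub>\<le>\<^sub>0"
      using assms by (auto dest: nonpos_Ints_nonpos)
    moreover have "Gamma a > 0" "Gamma (a + d) > 0"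
      using assms by (auto intro: Gamma_real_pos)
    ultimately show ?thesis
      by (simp add: Beta_def pochhammer_Gamma add_ac)
  qed
  finally show ?thesis .
qed

lemma appell_F1_term_nonneg:
  fixes \<alpha> \<beta>1 \<beta>2 \<gamma> x y :: real
  assumes "\<alpha> > 0" "\<beta>1 > 0" "\<beta>2 > 0" "\<gamma> > 0" "x \<ge> 0" "y \<ge> 0"
  shows "appell_F1_term \<alpha> \<beta>1 \<beta>2 \<gamma> x y p \<ge> 0"
  using assms unfolding appell_F1_term_def case_prod_unfold
  by (intro divide_nonneg_nonneg mult_nonneg_nonneg pochhammer_nonneg zero_le_power) auto

text \<open>Both binomial factors are expanded and integrated term by term. Positive parameters make
  every term nonnegative, so in \<open>ennreal\<close> sum and integral may be exchanged with no
  integrability condition.\<close>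

lemma appell_F1_Euler_nn_integral:
  fixes \<alpha> \<beta>1 \<beta>2 \<delta> x y S :: real
  assumes pos: "\<alpha> > 0" "\<delta> > 0" "\<beta>1 > 0" "\<beta>2 > 0" and xy: "0 \<le> x" "x < 1" "0 \<le> y" "y < 1"
    and S: "(appell_F1_term \<alpha> \<beta>1 \<beta>2 (\<alpha> + \<delta>) x y has_sum S) UNIV"
  shows "(\<integral>\<^sup>+t. ennreal (t powr (\<alpha> - 1) * (1 - t) powr (\<delta> - 1) * (1 - x * t) powr (- \<beta>1) *
            (1 - y * t) powr (- \<beta>2)) * indicator {0..1} t \<partial>lborel) = ennreal (Beta \<alpha> \<delta> * S)"
proof -
  define c where "c = appell_F1_term \<alpha> \<beta>1 \<beta>2 (\<alpha> + \<delta>) x y"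
  define w where "w = (\<lambda>t. t powr (\<alpha> - 1) * (1 - t) powr (\<delta> - 1) :: real)"
  define u where "u = (\<lambda>m. pochhammer \<beta>1 m / pochhammer 1 m * x ^ m)"
  define v where "v = (\<lambda>n. pochhammer \<beta>2 n / pochhammer 1 n * y ^ n)"
  have nonneg: "w t \<ge> 0" "u m \<ge> 0" "v n \<ge> 0" for t m n
    using pos xy by (auto simp: w_def u_def v_def intro!: divide_nonneg_nonneg mult_nonneg_nonneg pochhammer_nonneg)
  have c_nonneg: "c p \<ge> 0" for p
    using pos xy by (auto simp: c_def intro: appell_F1_term_nonneg)
  have Beta_pos: "Beta \<alpha> \<delta> \<ge> 0"
    using pos by (simp add: Beta_def Gamma_real_pos less_imp_le)
  have integrand: "ennreal (w t * (1 - x * t) powr (- \<beta>1) * (1 - y * t) powr (- \<beta>2)) =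
      (\<Sum>m. \<Sum>n. ennreal (w t * t ^ (m + n) * u m * v n))" if t: "t \<in> {0..1}" for t
  proof -
    have xt: "\<bar>x * t\<bar> < 1" "\<bar>y * t\<bar> < 1"
      using t xy mult_left_le[of t x] mult_left_le[of t y] by auto
    have U: "(\<lambda>m. t ^ m * u m) sums (1 - x * t) powr (- \<beta>1)"
      using binomial_series_pochhammer_real[OF xt(1), of \<beta>1] by (simp add: u_def power_mult_distrib mult_ac)
    have V: "(\<lambda>n. t ^ n * v n) sums (1 - y * t) powr (- \<beta>2)"
      using binomial_series_pochhammer_real[OF xt(2), of \<beta>2] by (simp add: v_def power_mult_distrib mult_ac)
    have "(\<lambda>n. w t * t ^ (m + n) * u m * v n) sums (w t * (t ^ m * u m) * (1 - y * t) powr (- \<beta>2))" for m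
      using sums_mult[OF V, of "w t * (t ^ m * u m)"] by (simp add: power_add mult_ac)
    hence "(\<Sum>n. ennreal (w t * t ^ (m + n) * u m * v n)) =
             ennreal (w t * (t ^ m * u m) * (1 - y * t) powr (- \<beta>2))" for m
      using t by (intro suminf_ennreal_eq) (auto intro!: mult_nonneg_nonneg nonneg)
    moreover have "(\<lambda>m. w t * (t ^ m * u m) * (1 - y * t) powr (- \<beta>2)) sums
        (w t * (1 - x * t) powr (- \<beta>1) * (1 - y * t) powr (- \<beta>2))"
      by (intro sums_mult sums_mult2 U)
    hence "(\<Sum>m. ennreal (w t * (t ^ m * u m) * (1 - y * t) powr (- \<beta>2))) =
        ennreal (w t * (1 - x * t) powr (- \<beta>1) * (1 - y * t) powr (- \<beta>2))"
      using t by (intro suminf_ennreal_eq) (auto intro!: mult_nonneg_nonneg nonneg)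
    ultimately show ?thesis by simp
  qed
  have [measurable]: "w \<in> borel_measurable borel"
    unfolding w_def by measurable
  have moment: "(\<integral>\<^sup>+t. ennreal (w t * t ^ (m + n) * u m * v n) * indicator {0..1} t \<partial>lborel) =
                ennreal (Beta \<alpha> \<delta> * c (m, n))" for m n
  proof -
    have "(\<integral>\<^sup>+t. ennreal (w t * t ^ (m + n) * u m * v n) * indicator {0..1} t \<partial>lborel) =
          (\<integral>\<^sup>+t. ennreal (u m * v n) * (ennreal (w t * t ^ (m + n)) * indicator {0..1} t) \<partial>lborel)"
      using nonneg by (intro nn_integral_cong)
        (auto simp: indicator_def mult_ac simp flip: ennreal_mult' ennreal_mult'')
    also have "\<dots> = ennreal (u m * v n) * ennreal (Beta \<alpha> \<delta> * (pochhammer \<alpha> (m + n) / pochhammer (\<alpha> + \<delta>) (m + n)))"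
      by (subst nn_integral_cmult) (auto simp: nn_integral_Beta_moment pos w_def)
    also have "\<dots> = ennreal (u m * v n * (Beta \<alpha> \<delta> * (pochhammer \<alpha> (m + n) / pochhammer (\<alpha> + \<delta>) (m + n))))"
      by (rule ennreal_mult'[symmetric]) (intro mult_nonneg_nonneg nonneg)
    also have "u m * v n * (Beta \<alpha> \<delta> * (pochhammer \<alpha> (m + n) / pochhammer (\<alpha> + \<delta>) (m + n))) = Beta \<alpha> \<delta> * c (m, n)"
      by (simp add: c_def u_def v_def appell_F1_term_def mult_ac)
    finally show ?thesis .
  qed
  have "(\<integral>\<^sup>+t. ennreal (w t * (1 - x * t) powr (- \<beta>1) * (1 - y * t) powr (- \<beta>2)) * indicator {0..1} t \<partial>lborel) =
        (\<integral>\<^sup>+t. (\<Sum>m. \<Sum>n. ennreal (w t * t ^ (m + n) * u m * v n) * indicator {0..1} t) \<partial>lborel)"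
    by (intro nn_integral_cong) (auto simp: indicator_def integrand)
  also have "\<dots> = (\<Sum>m. \<integral>\<^sup>+t. (\<Sum>n. ennreal (w t * t ^ (m + n) * u m * v n) * indicator {0..1} t) \<partial>lborel)"
    by (rule nn_integral_suminf) measurable
  also have "\<dots> = (\<Sum>m. \<Sum>n. \<integral>\<^sup>+t. ennreal (w t * t ^ (m + n) * u m * v n) * indicator {0..1} t \<partial>lborel)"
    by (intro suminf_cong nn_integral_suminf) measurable
  also have "\<dots> = (\<Sum>m. \<Sum>n. ennreal (Beta \<alpha> \<delta> * c (m, n)))"
    by (simp only: moment)
  also have "\<dots> = ennreal (Beta \<alpha> \<delta> * S)"
  proof -
    \<comment> \<open>The unordered sum over pairs is regrouped into row sums \<open>g m\<close> to
      match the iterated series.\<close>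
    have hs: "((\<lambda>p. Beta \<alpha> \<delta> * c p) has_sum (Beta \<alpha> \<delta> * S)) (UNIV \<times> UNIV)"
      using S by (intro has_sum_cmult_right) (simp add: c_def)
    define g where "g = (\<lambda>m. \<Sum>\<^sub>\<infinity>n. Beta \<alpha> \<delta> * c (m, n))"
    have g: "((\<lambda>n. Beta \<alpha> \<delta> * c (m, n)) has_sum g m) UNIV" for m
      unfolding g_def using hs
      by (intro has_sum_infsum summable_on_SigmaD1[where A = UNIV and B = "\<lambda>_. UNIV" and f = "\<lambda>m n. Beta \<alpha> \<delta> * c (m, n)"])
        (auto simp: summable_on_def case_prod_unfold)
    have "(\<Sum>n. ennreal (Beta \<alpha> \<delta> * c (m, n))) = ennreal (g m)" for m
      using Beta_pos c_nonneg by (intro suminf_ennreal_eq has_sum_imp_sums g) auto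
    moreover have "(\<Sum>m. ennreal (g m)) = ennreal (Beta \<alpha> \<delta> * S)"
    proof (intro suminf_ennreal_eq has_sum_imp_sums has_sum_SigmaD[OF hs g])
      show "g m \<ge> 0" for m
        unfolding g_def using Beta_pos c_nonneg by (intro infsum_nonneg) auto
    qed
    ultimately show ?thesis by simp
  qed
  finally show ?thesis
    by (simp add: w_def)
qed

section \<open>The substitution\<close>

text \<open>The cubic \<open>P\<close> and the substitution \<open>s\<close> as a function of \<open>t\<close>.\<close>

definition belyi_P :: "real \<Rightarrow> real" where
  "belyi_P t = 1 - 21 / 32 * t - 81 / 2048 * t ^ 2 + t ^ 3 / 1024"

definition belyi :: "real \<Rightarrow> real" where
  "belyi t = 3125 / 32768 * t ^ 3 * (1 - 3 / 128 * t) / belyi_P t ^ 2"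

lemma belyi_0: "belyi 0 = 0" and belyi_1: "belyi 1 = 1"
  by (simp_all add: belyi_def belyi_P_def power2_eq_square)

text \<open>On the unit interval \<open>P\<close> is at least \<open>1 - 21/32 - 81/2048\<close>, so
  the substitution has no pole there.\<close>

lemma belyi_P_pos:
  assumes "t \<in> {0..1}"
  shows "belyi_P t > 0"
proof -
  have "t ^ 2 \<le> 1" "t ^ 3 \<ge> 0"
    using assms by (auto intro: power_le_one)
  thus ?thesis
    using assms unfolding belyi_P_def atLeastAtMost_iff by linarith
qed

lemma one_minus_belyi:
  assumes "t \<in> {0..1}"
  shows "1 - belyi t = (1 - t) * (1 - 1 / 16 * t) ^ 5 / belyi_P t ^ 2"
proof -
  have "1 - belyi t = (belyi_P t ^ 2 - 3125 / 32768 * t ^ 3 * (1 - 3 / 128 * t)) / belyi_P t ^ 2"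
    using belyi_P_pos[OF assms] by (simp add: belyi_def diff_divide_distrib)
  \<comment> \<open>This polynomial identity of degree six is what singles out the cubic
    \<open>P\<close>.\<close>
  also have "belyi_P t ^ 2 - 3125 / 32768 * t ^ 3 * (1 - 3 / 128 * t) = (1 - t) * (1 - 1 / 16 * t) ^ 5"
    unfolding belyi_P_def by (simp add: field_simps power2_eq_square eval_nat_numeral)
  finally show ?thesis .
qed

text \<open>The map has degree six and is ramified only over 0, 1 and infinity: a triple zero at 0,
  a fivefold point over 1 at \<open>t = 16\<close>, double poles at the roots of \<open>P\<close>,
  and a double zero at infinity. Hence the numerator of the derivative is a constant times
  \<open>t ^ 2 * (1 - t / 16) ^ 4\<close>.\<close>

lemma belyi_has_real_derivative:
  assumes "t \<in> {0..1}"
  shows "(belyi has_real_derivative 9375 / 32768 * t ^ 2 * (1 - 1 / 16 * t) ^ 4 / belyi_P t ^ 3) (at t)"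
proof -
  define P' where "P' = - 21 / 32 - 81 / 1024 * t + 3 * t ^ 2 / 1024"
  define U' where "U' = 3125 / 32768 * (3 * t ^ 2 - 3 / 32 * t ^ 3)"
  define U where "U = 3125 / 32768 * t ^ 3 * (1 - 3 / 128 * t)"
  have P: "(belyi_P has_real_derivative P') (at t)"
    unfolding belyi_P_def P'_def by (auto intro!: derivative_eq_intros simp: field_simps eval_nat_numeral)
  have U: "((\<lambda>t. 3125 / 32768 * t ^ 3 * (1 - 3 / 128 * t)) has_real_derivative U') (at t)"
    unfolding U'_def by (auto intro!: derivative_eq_intros simp: field_simps eval_nat_numeral)
  have "belyi_P t \<noteq> 0" using belyi_P_pos[OF assms] by simp
  have "((\<lambda>t. belyi_P t ^ 2) has_real_derivative 2 * belyi_P t * P') (at t)"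
    using DERIV_power[OF P, of 2] by (simp add: mult_ac)
  hence "(belyi has_real_derivative (U' * belyi_P t ^ 2 - U * (2 * belyi_P t * P')) /
          (belyi_P t ^ 2 * belyi_P t ^ 2)) (at t)"
    unfolding belyi_def U_def using \<open>belyi_P t \<noteq> 0\<close> by (intro DERIV_divide U) auto
  moreover have "U' * belyi_P t ^ 2 - U * (2 * belyi_P t * P') = (U' * belyi_P t - 2 * U * P') * belyi_P t"
    by (simp add: algebra_simps power2_eq_square)
  moreover have "U' * belyi_P t - 2 * U * P' = 9375 / 32768 * t ^ 2 * (1 - 1 / 16 * t) ^ 4"
    unfolding U'_def U_def P'_def belyi_P_def by (simp add: field_simps eval_nat_numeral)
  moreover have "c * belyi_P t / (belyi_P t ^ 2 * belyi_P t ^ 2) = c / belyi_P t ^ 3" for c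
    using \<open>belyi_P t \<noteq> 0\<close> by (simp add: field_simps eval_nat_numeral)
  ultimately show ?thesis
    by (simp only:)
qed

text \<open>The exponents of \<open>P\<close> add up to
  \<open>-2 * (a - 1) + 2 * (1 / 2 + a) - 3 = 0\<close>, so the cubic disappears. Those of the
  linear factors become the ones in Euler's integral for the given parameters.\<close>

lemma belyi_pullback_Beta_integrand:
  assumes "t \<in> {0..1}"
  shows "belyi t powr (a - 1) * (1 - belyi t) powr (- 1 / 2 - a) *
           (9375 / 32768 * t ^ 2 * (1 - 1 / 16 * t) ^ 4 / belyi_P t ^ 3) =
         3 * (3125 / 32768) powr a * (t powr (3 * a - 1) * (1 - t) powr (- 1 / 2 - a) *
           (1 - 3 / 128 * t) powr (a - 1) * (1 - 1 / 16 * t) powr (3 / 2 - 5 * a))"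
proof (cases "t = 0 \<or> t = 1")
  case True
  \<comment> \<open>At either endpoint a factor with base 0 makes both sides 0, whatever its
    exponent.\<close>
  thus ?thesis by (auto simp: belyi_0 belyi_1)
next
  case False
  hence t: "0 < t" "0 < 1 - t" "0 < 1 - 3 / 128 * t" "0 < 1 - 1 / 16 * t"
    using assms by auto
  define P A B C where "P = belyi_P t" and "A = 1 - 3 / 128 * t" and "B = 1 - t" and "C = 1 - 1 / 16 * t"
  have pos: "P > 0" "A > 0" "B > 0" "C > 0"
    using t belyi_P_pos[OF assms] by (auto simp: P_def A_def B_def C_def)
  define k :: real where "k = 3125 / 32768"
  have "k > 0" by (simp add: k_def)
  have "(k * t ^ 3 * A / P ^ 2) powr (a - 1) * (B * C ^ 5 / P ^ 2) powr (- 1 / 2 - a) * (3 * k * t ^ 2 * C ^ 4 / P ^ 3) =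
     3 * k powr a * (t powr (3 * a - 1) * B powr (- 1 / 2 - a) * A powr (a - 1) * C powr (3 / 2 - 5 * a))"
  proof -
    \<comment> \<open>All bases are positive, so taking logarithms reduces the claim to an identity
      linear in \<open>ln k\<close>, \<open>ln t\<close>, \<open>ln A\<close>, \<open>ln B\<close>,
      \<open>ln C\<close> and \<open>ln P\<close>.\<close>
    have *: "x ^ n = exp (real n * ln x)" if "x > 0" for x :: real and n
      using that by (simp add: exp_of_nat_mult)
    have e1: "3 * k * t ^ 2 * C ^ 4 / P ^ 3 = 3 * exp (ln k + 2 * ln t + 4 * ln C - 3 * ln P)"
      using pos t \<open>k > 0\<close> by (simp add: exp_add exp_diff * )
    have e2: "(k * t ^ 3 * A / P ^ 2) powr (a - 1) = exp ((a - 1) * (ln k + 3 * ln t + ln A - 2 * ln P))"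
      using pos t \<open>k > 0\<close> by (simp add: powr_def ln_mult ln_div ln_realpow)
    have e3: "(B * C ^ 5 / P ^ 2) powr (- 1 / 2 - a) = exp ((- 1 / 2 - a) * (ln B + 5 * ln C - 2 * ln P))"
      using pos t \<open>k > 0\<close> by (simp add: powr_def ln_mult ln_div ln_realpow)
    have "(k * t ^ 3 * A / P ^ 2) powr (a - 1) * (B * C ^ 5 / P ^ 2) powr (- 1 / 2 - a) * (3 * k * t ^ 2 * C ^ 4 / P ^ 3) =
       3 * exp ((a - 1) * (ln k + 3 * ln t + ln A - 2 * ln P) + (- 1 / 2 - a) * (ln B + 5 * ln C - 2 * ln P) +
         (ln k + 2 * ln t + 4 * ln C - 3 * ln P))"
      unfolding e1 e2 e3 by (simp only: exp_add mult_ac)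
    also have "(a - 1) * (ln k + 3 * ln t + ln A - 2 * ln P) + (- 1 / 2 - a) * (ln B + 5 * ln C - 2 * ln P) +
        (ln k + 2 * ln t + 4 * ln C - 3 * ln P) =
        a * ln k + ((3 * a - 1) * ln t + (- 1 / 2 - a) * ln B + (a - 1) * ln A + (3 / 2 - 5 * a) * ln C)"
      by (simp add: field_simps)
    also have "3 * exp \<dots> = 3 * k powr a * (t powr (3 * a - 1) * B powr (- 1 / 2 - a) * A powr (a - 1) * C powr (3 / 2 - 5 * a))"
      using pos t \<open>k > 0\<close> by (simp add: powr_def exp_add)
    finally show ?thesis .
  qed
  thus ?thesis
    unfolding one_minus_belyi[OF assms] by (simp add: belyi_def k_def P_def A_def B_def C_def)
qed

text \<open>Since its derivative is nonnegative, \<open>belyi\<close> maps the unit interval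
  monotonically onto itself. The bounds on \<open>a\<close> make both Beta parameters
  positive.\<close>

lemma Beta_eq_pullback_nn_integral:
  assumes "0 < a" "a < 1 / 2"
  shows "ennreal (Beta a (1 / 2 - a)) = ennreal (3 * (3125 / 32768) powr a) *
    (\<integral>\<^sup>+t. ennreal (t powr (3 * a - 1) * (1 - t) powr (- 1 / 2 - a) *
           (1 - 3 / 128 * t) powr (a - 1) * (1 - 1 / 16 * t) powr (3 / 2 - 5 * a)) * indicator {0..1} t \<partial>lborel)"
proof -
  let ?g' = "\<lambda>t. 9375 / 32768 * t ^ 2 * (1 - 1 / 16 * t) ^ 4 / belyi_P t ^ 3 :: real"
  let ?f = "\<lambda>s. s powr (a - 1) * (1 - s) powr (- 1 / 2 - a)"
  define h where "h = (\<lambda>t :: real. t powr (3 * a - 1) * (1 - t) powr (- 1 / 2 - a) *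
    (1 - 3 / 128 * t) powr (a - 1) * (1 - 1 / 16 * t) powr (3 / 2 - 5 * a))"
  have [measurable]: "h \<in> borel_measurable borel"
    unfolding h_def by (intro borel_measurable_times powr_real_measurable borel_measurable_diff) simp_all
  have "(?f has_integral Beta a (1 / 2 - a)) {0..1}"
  proof -
    have "1 / 2 - a - 1 = - 1 / 2 - a"
      by simp
    thus ?thesis
      using has_integral_Beta_real[of a "1 / 2 - a"] assms by (simp only:)
  qed
  hence "ennreal (Beta a (1 / 2 - a)) = (\<integral>\<^sup>+s. ennreal (?f s) * indicator {0..1} s \<partial>lborel)"
    by (intro nn_integral_has_integral_lebesgue'[symmetric]) auto
  also have "\<dots> = (\<integral>\<^sup>+s. ennreal (?f s * indicator {belyi 0..belyi 1} s) \<partial>lborel)"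
    by (intro nn_integral_cong) (auto simp: indicator_def belyi_0 belyi_1)
  also have "\<dots> = (\<integral>\<^sup>+t. ennreal (?f (belyi t) * ?g' t * indicator {0..1} t) \<partial>lborel)"
  proof (rule nn_integral_substitution)
    show "set_borel_measurable borel {belyi 0..belyi 1} ?f"
      unfolding set_borel_measurable_def by measurable
    show "continuous_on {0..1} ?g'"
    proof -
      have "continuous_on {0..1} belyi_P"
        unfolding belyi_P_def by (intro continuous_intros) auto
      moreover have "belyi_P t ^ 3 \<noteq> 0" if "t \<in> {0..1}" for t
        using belyi_P_pos[OF that] by simp
      ultimately show ?thesis
        by (intro continuous_intros) auto
    qed
    show "?g' t \<ge> 0" if "t \<in> {0..1}" for t
      using belyi_P_pos[OF that] by simp
  qed (simp_all only: belyi_has_real_derivative zero_le_one)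
  also have "\<dots> = (\<integral>\<^sup>+t. ennreal (3 * (3125 / 32768) powr a) * (ennreal (h t) * indicator {0..1} t) \<partial>lborel)"
  proof (rule nn_integral_cong)
    fix t :: real
    show "ennreal (?f (belyi t) * ?g' t * indicator {0..1} t) =
            ennreal (3 * (3125 / 32768) powr a) * (ennreal (h t) * indicator {0..1} t)"
    proof (cases "t \<in> {0..1}")
      case True
      have "ennreal (?f (belyi t) * ?g' t) = ennreal (3 * (3125 / 32768) powr a * h t)"
        by (simp only: belyi_pullback_Beta_integrand[OF True] h_def)
      also have "\<dots> = ennreal (3 * (3125 / 32768) powr a) * ennreal (h t)"
        by (rule ennreal_mult') simp
      finally show ?thesis
        by (simp only: indicator_simps(1)[OF True] mult_1_right)
    qed simp
  qed
  also have "\<dots> = ennreal (3 * (3125 / 32768) powr a) * (\<integral>\<^sup>+t. ennreal (h t) * indicator {0..1} t \<partial>lborel)"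
    by (rule nn_integral_cmult) measurable
  finally show ?thesis
    by (simp only: h_def)
qed

section \<open>The special value\<close>

lemma appell_F1_term_of_real:
  "appell_F1_term (of_real \<alpha>) (of_real \<beta>1) (of_real \<beta>2) (of_real \<gamma>) (of_real x) (of_real y) p =
     (of_real (appell_F1_term \<alpha> \<beta>1 \<beta>2 \<gamma> x y p) :: complex)"
  by (cases p) (simp add: appell_F1_term_def flip: pochhammer_of_real pochhammer_fact)

text \<open>Summability is known for the complex series; taking real parts passes it to the real
  one.\<close>

lemma appell_F1_of_real:
  fixes \<alpha> \<beta>1 \<beta>2 \<gamma> x y :: real
  assumes "\<gamma> > 0" "\<bar>x\<bar> < 1" "\<bar>y\<bar> < 1"
  shows "\<exists>S. (appell_F1_term \<alpha> \<beta>1 \<beta>2 \<gamma> x y has_sum S) UNIV \<and>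
    appell_F1 (of_real \<alpha>) (of_real \<beta>1) (of_real \<beta>2) (of_real \<gamma>) (of_real x) (of_real y) = of_real S"
proof -
  have "complex_of_real \<gamma> \<notin> \<int>\<^sub>\<le>\<^sub>0"
    using assms(1) by (auto simp: of_real_in_nonpos_Ints_iff dest: nonpos_Ints_nonpos)
  hence "appell_F1_term (complex_of_real \<alpha>) (of_real \<beta>1) (of_real \<beta>2) (of_real \<gamma>) (of_real x) (of_real y) summable_on UNIV"
    using assms by (intro appell_F1_summable) auto
  hence "(\<lambda>p. complex_of_real (appell_F1_term \<alpha> \<beta>1 \<beta>2 \<gamma> x y p)) summable_on UNIV"
    by (simp add: appell_F1_term_of_real[abs_def])
  from summable_on_Re[OF this]
  obtain S where S: "(appell_F1_term \<alpha> \<beta>1 \<beta>2 \<gamma> x y has_sum S) UNIV"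
    by (auto simp: summable_on_def)
  hence "((\<lambda>p. complex_of_real (appell_F1_term \<alpha> \<beta>1 \<beta>2 \<gamma> x y p)) has_sum of_real S) UNIV"
    by (rule has_sum_of_real)
  hence "appell_F1 (of_real \<alpha>) (of_real \<beta>1) (of_real \<beta>2) (of_real \<gamma>) (of_real x) (of_real y) = of_real S"
    by (simp add: appell_F1_eq_infsum appell_F1_term_of_real[abs_def] infsumI)
  with S show ?thesis by blast
qed

text \<open>Euler's integral with second Beta parameter \<open>1 / 2 - a\<close> is the pulled-back
  integral, and \<open>Gamma (1 / 2 - a)\<close> cancels between the two Beta values. The lower
  bound on \<open>a\<close> makes \<open>5 * a - 3 / 2\<close> positive, the upper one
  \<open>1 / 2 - a\<close>; \<open>sqrt pi\<close> is \<open>Gamma (1 / 2)\<close>.\<close>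

lemma appell_F1_special_value_real:
  fixes a :: real
  assumes a: "3 / 10 < a" "a < 1 / 2"
    and S: "(appell_F1_term (3 * a) (1 - a) (5 * a - 3 / 2) (2 * a + 1 / 2) (3 / 128) (1 / 16) has_sum S) UNIV"
  shows "S = 2 powr (15 * a) / (3 * 5 powr (5 * a)) *
               (Gamma a * rGamma (3 * a) * Gamma (2 * a + 1 / 2) / sqrt pi)"
proof -
  let ?k = "(3125 / 32768 :: real) powr a"
  \<comment> \<open>Nonnegativity allows the final \<open>ennreal\<close> equation to be read as one
    between reals.\<close>
  have "S \<ge> 0"
    by (rule has_sum_nonneg[OF S], rule appell_F1_term_nonneg) (use a in auto)
  have eqs: "3 * a + (1 / 2 - a) = 2 * a + 1 / 2" "1 / 2 - a - 1 = - 1 / 2 - a" "- (1 - a) = a - 1"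
    "- (5 * a - 3 / 2) = 3 / 2 - 5 * a"
    by simp_all
  have G: "Gamma a > 0" "Gamma (3 * a) > 0" "Gamma (2 * a + 1 / 2) > 0" "Gamma (1 / 2 - a) > 0"
    using a by (auto intro!: Gamma_real_pos)
  have B: "Beta (3 * a) (1 / 2 - a) \<ge> 0" "Beta a (1 / 2 - a) \<ge> 0"
    using G a by (simp_all add: Beta_def add_divide_distrib Gamma_real_pos less_imp_le)
  have "ennreal (Beta a (1 / 2 - a)) = ennreal (3 * ?k) * ennreal (Beta (3 * a) (1 / 2 - a) * S)"
    using appell_F1_Euler_nn_integral[of "3 * a" "1 / 2 - a" "1 - a" "5 * a - 3 / 2" "3 / 128" "1 / 16" S]
      Beta_eq_pullback_nn_integral[of a] a S
    unfolding eqs by simp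
  also have "\<dots> = ennreal (3 * ?k * (Beta (3 * a) (1 / 2 - a) * S))"
    by (rule ennreal_mult'[symmetric]) simp
  finally have "Beta a (1 / 2 - a) = 3 * ?k * (Beta (3 * a) (1 / 2 - a) * S)"
    using B \<open>S \<ge> 0\<close> by (subst (asm) ennreal_inj) auto
  moreover have "?k = 5 powr (5 * a) / 2 powr (15 * a)"
  proof -
    \<comment> \<open>Here \<open>3125 = 5 ^ 5\<close> and \<open>32768 = 2 ^ 15\<close>.\<close>
    have "(5 :: real) powr (5 * a) = 3125 powr a" "(2 :: real) powr (15 * a) = 32768 powr a"
      by (simp_all flip: powr_powr)
    thus ?thesis by (simp add: powr_divide)
  qed
  moreover have "Beta a (1 / 2 - a) = Gamma a * Gamma (1 / 2 - a) / sqrt pi"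
    by (simp add: Beta_def Gamma_one_half_real)
  moreover have "Beta (3 * a) (1 / 2 - a) = Gamma (3 * a) * Gamma (1 / 2 - a) / Gamma (2 * a + 1 / 2)"
    unfolding Beta_def eqs ..
  ultimately have "Gamma a * Gamma (1 / 2 - a) / sqrt pi = 3 * (5 powr (5 * a) / 2 powr (15 * a)) *
      (Gamma (3 * a) * Gamma (1 / 2 - a) / Gamma (2 * a + 1 / 2) * S)"
    by (simp only:)
  thus ?thesis
    using G by (simp add: rGamma_inverse_Gamma field_simps)
qed

theorem mainTheorem10:
  fixes a :: complex
  assumes "2 * a + 1 / 2 \<notin> \<int>\<^sub>\<le>\<^sub>0"
  shows "appell_F1 (3 * a) (1 - a) (5 * a - 3 / 2) (2 * a + 1 / 2) (3 / 128) (1 / 16) =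
           2 powr (15 * a) / (3 * 5 powr (5 * a)) *
           (Gamma_quot3 a * Gamma (2 * a + 1 / 2) / complex_of_real (sqrt pi))"
proof -
  define F where "F = (\<lambda>a. appell_F1 (3 * a) (1 - a) (5 * a - 3 / 2) (2 * a + 1 / 2) (3 / 128) (1 / 16))"
  define R where "R = (\<lambda>a. 2 powr (15 * a) / (3 * 5 powr (5 * a)) *
           (Gamma_quot3 a * Gamma (2 * a + 1 / 2) / complex_of_real (sqrt pi)))"
  define T where "T = {a :: complex. 2 * a + 1 / 2 \<in> \<int>\<^sub>\<le>\<^sub>0}"
  define U where "U = complex_of_real ` {3 / 10<..<1 / 2}"
  have "T \<subseteq> (\<lambda>z. (z - 1 / 2) / 2) ` \<int>\<^sub>\<le>\<^sub>0"
  proof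
    fix z assume "z \<in> T"
    thus "z \<in> (\<lambda>z. (z - 1 / 2) / 2) ` \<int>\<^sub>\<le>\<^sub>0"
      by (intro image_eqI[of _ _ "2 * z + 1 / 2"]) (auto simp: T_def)
  qed
  moreover have "countable (\<int>\<^sub>\<le>\<^sub>0 :: complex set)"
    by (rule countable_subset[of _ "range of_int"]) (auto simp: nonpos_Ints_def)
  ultimately have "countable T"
    by (meson countable_image countable_subset)
  \<comment> \<open>The plane minus countably many points stays connected, so an identity valid near
    one point spreads to all of \<open>- T\<close>.\<close>
  hence conn: "connected (- T)"
    using connected_open_diff_countable[of "UNIV :: complex set" T] by (simp add: Compl_eq_Diff_UNIV connected_UNIV)
  have "closed T"
    unfolding T_def
    using closed_vimage[OF closed_nonpos_Ints, of "\<lambda>a :: complex. 2 * a + 1 / 2"]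
    by (simp add: vimage_def continuous_intros)
  hence "open (- T)" by auto
  have "F holomorphic_on - T"
    unfolding F_def using \<open>open (- T)\<close>
    by (intro holomorphic_appell_F1 holomorphic_intros) (auto simp: T_def)
  moreover have "R holomorphic_on - T"
  proof -
    have "Gamma_quot3 holomorphic_on - T"
      using Gamma_quot3_analytic analytic_on_analytic_at analytic_imp_holomorphic by blast
    thus ?thesis
      unfolding R_def by (intro holomorphic_intros) (auto simp: T_def)
  qed
  ultimately have hol: "(\<lambda>a. F a - R a) holomorphic_on - T"
    by (intro holomorphic_intros)
  have U: "U \<subseteq> - T"
  proof
    fix z assume "z \<in> U"
    then obtain r where r: "z = of_real r" "3 / 10 < r"
      by (auto simp: U_def)
    have "2 * z + 1 / 2 = of_real (2 * r + 1 / 2)"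
      by (simp add: r)
    thus "z \<in> - T"
      using r(2) unfolding T_def by (auto simp only: of_real_in_nonpos_Ints_iff Compl_iff mem_Collect_eq dest!: nonpos_Ints_nonpos)
  qed
  have eq: "F z - R z = 0" if z: "z \<in> U" for z
  proof -
    obtain r where r: "z = of_real r" "3 / 10 < r" "r < 1 / 2"
      using z by (auto simp: U_def)
    obtain S where S: "(appell_F1_term (3 * r) (1 - r) (5 * r - 3 / 2) (2 * r + 1 / 2) (3 / 128) (1 / 16) has_sum S) UNIV"
      "F z = of_real S"
      using appell_F1_of_real[of "2 * r + 1 / 2" "3 / 128" "1 / 16" "3 * r" "1 - r" "5 * r - 3 / 2"] r
      unfolding F_def by auto
    \<comment> \<open>Away from the poles \<open>Gamma_quot3\<close> is the plain product, which is
      real at real arguments.\<close>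
    have "z \<notin> \<int>\<^sub>\<le>\<^sub>0"
      using r by (auto simp: of_real_in_nonpos_Ints_iff dest: nonpos_Ints_nonpos)
    hence "Gamma_quot3 z = of_real (Gamma r * rGamma (3 * r))"
      using rGamma_complex_of_real[of "3 * r"] by (simp add: Gamma_quot3_eq r(1) Gamma_complex_of_real)
    moreover have "Gamma (2 * z + 1 / 2) = of_real (Gamma (2 * r + 1 / 2))"
      using Gamma_complex_of_real[of "2 * r + 1 / 2"] by (simp add: r(1))
    moreover have "2 powr (15 * z) = of_real (2 powr (15 * r))" "5 powr (5 * z) = of_real (5 powr (5 * r))"
      using powr_of_real[of 2 "15 * r"] powr_of_real[of 5 "5 * r"] by (simp_all add: r(1))
    ultimately have "R z = of_real S"
      unfolding appell_F1_special_value_real[OF r(2,3) S(1)] by (simp add: R_def)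
    thus ?thesis using S(2) by simp
  qed
  \<comment> \<open>The midpoint of the real interval serves as accumulation point.\<close>
  have "of_real (2 / 5) islimpt U"
    unfolding islimpt_approachable
  proof (intro allI impI)
    fix e :: real assume "e > 0"
    \<comment> \<open>The cap \<open>1 / 20\<close> keeps \<open>x\<close> below
      \<open>1 / 2\<close>.\<close>
    define x where "x = 2 / 5 + min (e / 2) (1 / 20)"
    have "x \<in> {3 / 10<..<1 / 2}" "x \<noteq> 2 / 5" "\<bar>x - 2 / 5\<bar> < e"
      using \<open>e > 0\<close> by (auto simp: x_def)
    thus "\<exists>z\<in>U. z \<noteq> complex_of_real (2 / 5) \<and> dist z (complex_of_real (2 / 5)) < e"
      unfolding U_def
      by (intro bexI[of _ "of_real x"]) (auto simp only: of_real_eq_iff dist_of_real dist_real_def)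
  qed
  moreover have "complex_of_real (2 / 5) \<in> U"
    unfolding U_def by (rule imageI) simp
  hence "complex_of_real (2 / 5) \<in> - T"
    using U by blast
  moreover have "a \<in> - T"
    using assms by (simp add: T_def)
  ultimately have "F a - R a = 0"
    using analytic_continuation[OF hol \<open>open (- T)\<close> conn U] eq by blast
  thus ?thesis
    by (simp add: F_def R_def)
qed

end
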